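(* Let $\mathfrak{X}$ be a class of groups that is closed under taking quotients and direct products, and let a group $A$ act on a group $(G,\cdot)$ (groups not necessarily finite). Suppose that $G=A_1A_2\cdots A_k$ is a product of some $A$-invariant subgroups $A_i$, $1\le i\le k$. Write $H_0=G$, $H_i=A_{i+1}\cdots A_k$ for each $i\in\{1,\dots,k-1\}$, and $A_{k+1}=H_k=1$. Suppose that $A_i$ has an $A$-equivariant $\mathfrak{X}\mathrm{YB}$-structure $(A_i,+,\cdot)$ for each $i\in\{1,\dots,k\}$, satisfying the following conditions for each $i\in\{1,\dots,k\}$: \begin{itemize} \item[(1)] $A_i$ is normalised by $H_i$; \item[(2)] $(A_i,+,\cdot)$ is an $H_i$-equivariant $\mathfrak{X}\mathrm{YB}$-structure of $A_i$ with respect to the action by conjugation of $H_i$ on $A_i$: ${}^{h}a=hah^{-1}$ for $h\in H_i$, $a\in A_i$; \item[(3)] $A_1A_2\cdots A_i\cap H_i\le C_G(A_iA_{i+1})$; \item[(4)] $Z(A_i)\le \mathrm{Soc}(A_i)$. \end{itemize} Then $G$ has an $A$-equivariant $\mathfrak{X}\mathrm{YB}$-structure $(G,+,\cdot)$ satisfying the following property: ( * ) Suppose that $a=a_1a_2\cdots a_k\in Z(A_1)Z(A_2)\cdots Z(A_k)$, where $a_i\in Z(A_i)$ for each $i=1,\dots,k$, and $a_ia_{i+1}\cdots a_k\in C_G(A_{i-1})$ for each $i=2,\dots,k$. Then $a\in \mathrm{Soc}(G)$. Furthermore, $(A_i,+,\cdot)$ is a subbrace of $(G,+,\cdot)$ for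 every $i\in\{1,\dots,k\}$.
   Context: Groups here are not assumed finite. A skew left brace is a triple $(B,+,\cdot)$ where $(B,+)$ (not necessarily abelian) and $(B,\cdot)$ are groups with $a\cdot(b+c)=a\cdot b-a+a\cdot c$ for all $a,b,c\in B$. It is of $\mathfrak{X}$-type if $(B,+)$ belongs to $\mathfrak{X}$. An $\mathfrak{X}\mathrm{YB}$-structure on a group $(G,\cdot)$ is a skew left brace $(G,+,\cdot)$ of $\mathfrak{X}$-type whose multiplicative group is $(G,\cdot)$. For a skew left brace $B$ and $a\in B$, put $\lambda_a(b)=-a+ab$; then $\lambda:(B,\cdot)\to\mathrm{Aut}(B,+)$, $a\mapsto\lambda_a$, is a homomorphism. Set $\mathrm{Ker}(B)=\ker\lambda$ and $\mathrm{Soc}(B)=\mathrm{Ker}(B)\cap Z(B,+)=\{a\in B\mid ab=a+b=b+a\ \forall b\in B\}$. Here $Z(A_i)$ denotes the centre of the multiplicative group $(A_i,\cdot)$. Given an action of a group $A$ on a group $(G,\cdot)$ by automorphisms, an $\mathfrak{X}\mathrm{YB}$-structure $(G,+,\cdot)$ is $A$-equivariant if $A$ acts by automorphisms also on $(G,+)$, i.e. $a\cdot(g+h)=a\cdot g+a\cdot h$ and $a\cdot(gh)=(a\cdot g)(a\cdot h)$ for all $a\in A$, $g,h\in G$. The action of $A$ on an $A$-invariant subgroup $A_i$ is the restriction of the action on $G$. A subbrace is a subset that is a subgroup of both the additive and the multiplicative groups, with the induced operations. *)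

theory Defs
  imports "HOL-Algebra.Algebra"
begin

section \<open>Classes of groups\<close>

text \<open>
  A class of groups is given by its members with carrier inside a type \<open>'u\<close>; a group over any
  other type belongs to the class if it is isomorphic to one of these. In the closure conditions
  the quotient and the direct product live over the types \<open>'u set\<close> and \<open>'u \<times> 'u\<close>, so membership
  has to be taken in this sense. Closure under direct products thereby also expresses that \<open>'u\<close> is
  large enough to contain copies of the products of members. Only binary (hence all finite
  nonempty) products are required.
\<close>

definition in_class :: "('u monoid \<Rightarrow> bool) \<Rightarrow> ('g, 'm) monoid_scheme \<Rightarrow> bool" where
  "in_class \<XX> K \<longleftrightarrow> (\<exists>H. \<XX> H \<and> K \<cong> H)"

definition group_class :: "('u monoid \<Rightarrow> bool) \<Rightarrow> bool" where
  "group_class \<XX> \<longleftrightarrow> (\<forall>H. \<XX> H \<longrightarrow> group H)"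

definition quotient_closed :: "('u monoid \<Rightarrow> bool) \<Rightarrow> bool" where
  "quotient_closed \<XX> \<longleftrightarrow> (\<forall>H N. \<XX> H \<longrightarrow> N \<lhd> H \<longrightarrow> in_class \<XX> (H Mod N))"

definition product_closed :: "('u monoid \<Rightarrow> bool) \<Rightarrow> bool" where
  "product_closed \<XX> \<longleftrightarrow> (\<forall>H K. \<XX> H \<longrightarrow> \<XX> K \<longrightarrow> in_class \<XX> (H \<times>\<times> K))"


section \<open>Groups\<close>

definition group_center :: "('g, 'm) monoid_scheme \<Rightarrow> 'g set" where
  "group_center G = {z \<in> carrier G. \<forall>g \<in> carrier G. z \<otimes>\<^bsub>G\<^esub> g = g \<otimes>\<^bsub>G\<^esub> z}"

definition centralizer :: "('g, 'm) monoid_scheme \<Rightarrow> 'g set \<Rightarrow> 'g set" where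
  "centralizer G S = {x \<in> carrier G. \<forall>s \<in> S. x \<otimes>\<^bsub>G\<^esub> s = s \<otimes>\<^bsub>G\<^esub> x}"

text \<open>The ordered products \<open>A\<^sub>i A\<^sub>i\<^sub>+\<^sub>1 \<cdots> A\<^sub>j\<close> and \<open>a\<^sub>i a\<^sub>i\<^sub>+\<^sub>1 \<cdots> a\<^sub>j\<close>; trivial if \<open>j < i\<close>.\<close>

definition set_prod :: "('g, 'm) monoid_scheme \<Rightarrow> (nat \<Rightarrow> 'g set) \<Rightarrow> nat \<Rightarrow> nat \<Rightarrow> 'g set" where
  "set_prod G A i j = foldr (set_mult G) (map A [i..<Suc j]) {\<one>\<^bsub>G\<^esub>}"

definition elem_prod :: "('g, 'm) monoid_scheme \<Rightarrow> (nat \<Rightarrow> 'g) \<Rightarrow> nat \<Rightarrow> nat \<Rightarrow> 'g" where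
  "elem_prod G a i j = foldr (\<otimes>\<^bsub>G\<^esub>) (map a [i..<Suc j]) \<one>\<^bsub>G\<^esub>"


section \<open>Skew left braces\<close>

text \<open>
  A brace is carried by a \<open>ring\<close> record \<open>B\<close>: its multiplicative group is \<open>B\<close> itself and its
  additive group, which need not be commutative, is \<open>add_monoid B\<close>.
\<close>

locale skew_left_brace =
  fixes B (structure)
  assumes add_group: "group (add_monoid B)"
    and mult_group: "group B"
    and brace_distrib: "\<And>a b c. \<lbrakk>a \<in> carrier B; b \<in> carrier B; c \<in> carrier B\<rbrakk> \<Longrightarrow>
      a \<otimes> (b \<oplus> c) = a \<otimes> b \<ominus> a \<oplus> a \<otimes> c"

definition YB_structure ::
  "('u monoid \<Rightarrow> bool) \<Rightarrow> ('g, 'm) monoid_scheme \<Rightarrow> 'g ring \<Rightarrow> bool" where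
  "YB_structure \<XX> G B \<longleftrightarrow>
     skew_left_brace B \<and> in_class \<XX> (add_monoid B) \<and>
     carrier B = carrier G \<and>
     (\<forall>x \<in> carrier G. \<forall>y \<in> carrier G. x \<otimes>\<^bsub>B\<^esub> y = x \<otimes>\<^bsub>G\<^esub> y)"

definition brace_lambda :: "('g, 'm) ring_scheme \<Rightarrow> 'g \<Rightarrow> 'g \<Rightarrow> 'g" where
  "brace_lambda B a = (\<lambda>b \<in> carrier B. \<ominus>\<^bsub>B\<^esub> a \<oplus>\<^bsub>B\<^esub> a \<otimes>\<^bsub>B\<^esub> b)"

definition brace_Ker :: "('g, 'm) ring_scheme \<Rightarrow> 'g set" where
  "brace_Ker B = kernel B (AutoGroup (add_monoid B)) (brace_lambda B)"

definition brace_Soc :: "('g, 'm) ring_scheme \<Rightarrow> 'g set" where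
  "brace_Soc B = brace_Ker B \<inter> group_center (add_monoid B)"

lemma (in skew_left_brace) brace_Soc_eq:
  "brace_Soc B = {a \<in> carrier B. \<forall>b \<in> carrier B. a \<otimes> b = a \<oplus> b \<and> a \<oplus> b = b \<oplus> a}"
proof -
  interpret add: group "add_monoid B" by (rule add_group)
  interpret mul: group B by (rule mult_group)
  have "\<ominus> a \<oplus> a \<otimes> b = b \<longleftrightarrow> a \<otimes> b = a \<oplus> b" if "a \<in> carrier B" "b \<in> carrier B" for a b
    using that add.inv_solve_left'[of b a "a \<otimes> b"] by (simp add: a_inv_def)
  then have "a \<in> brace_Ker B \<longleftrightarrow> a \<in> carrier B \<and> (\<forall>b \<in> carrier B. a \<otimes> b = a \<oplus> b)" for a
    by (auto simp: brace_Ker_def kernel_def brace_lambda_def AutoGroup_def BijGroup_def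
        restrict_def fun_eq_iff)
  then show ?thesis
    by (auto simp: brace_Soc_def group_center_def)
qed

text \<open>
  \<open>S\<close> is (the underlying set of) the acting group and \<open>act\<close> its action, which is applied to
  elements of \<open>carrier B\<close> only; so an action on a larger set is implicitly restricted.
\<close>

definition equivariant :: "'a set \<Rightarrow> ('a \<Rightarrow> 'g \<Rightarrow> 'g) \<Rightarrow> 'g ring \<Rightarrow> bool" where
  "equivariant S act B \<longleftrightarrow>
     (\<forall>a \<in> S. \<forall>g \<in> carrier B. \<forall>h \<in> carrier B.
        act a (g \<oplus>\<^bsub>B\<^esub> h) = act a g \<oplus>\<^bsub>B\<^esub> act a h \<and>
        act a (g \<otimes>\<^bsub>B\<^esub> h) = act a g \<otimes>\<^bsub>B\<^esub> act a h)"

definition subbrace :: "'g ring \<Rightarrow> 'g ring \<Rightarrow> bool" where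
  "subbrace S B \<longleftrightarrow>
     subgroup (carrier S) (add_monoid B) \<and> subgroup (carrier S) B \<and>
     (\<forall>x \<in> carrier S. \<forall>y \<in> carrier S.
        x \<oplus>\<^bsub>S\<^esub> y = x \<oplus>\<^bsub>B\<^esub> y \<and> x \<otimes>\<^bsub>S\<^esub> y = x \<otimes>\<^bsub>B\<^esub> y)"

end

theory Submission
  imports Defs
begin

text \<open>
  Consider first two factors, \<open>G = AH\<close> with \<open>A\<close> normalised by \<open>H\<close>, and braces on \<open>A\<close> and \<open>H\<close> such
  that \<open>H\<close> acts on the brace \<open>A\<close> by conjugation. Then
  \<open>(a h) + (b g) = (a + b) (h + g)\<close> for \<open>a, b \<in> A\<close> and \<open>h, g \<in> H\<close> makes \<open>G\<close> a skew left brace,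
  provided that it is well defined. It is, because every element of \<open>A \<inter> H\<close> lies in the socles of
  both \<open>A\<close> and \<open>H\<close> (\<open>add_glued_well_defined\<close>). The formula alone yields the rest: the additive
  group is an image of the direct product of the two additive groups, so it stays in the class;
  both factors are subbraces; operators acting on both factors act on the glued brace; and \<open>z w\<close>
  is in the socle if \<open>z\<close> and \<open>w\<close> are and \<open>w\<close> centralises \<open>A\<close>.

  The theorem follows by adding the factors \<open>A\<^sub>k, \<dots>, A\<^sub>1\<close> one at a time, gluing \<open>A\<^sub>j\<close> to the brace
  on \<open>H\<^sub>j = A\<^sub>j\<^sub>+\<^sub>1 \<cdots> A\<^sub>k\<close> (\<open>exists_glued_brace\<close>). What must be shown is that
  \<open>A\<^sub>j \<inter> H\<^sub>j\<close> lies in both socles. An element of it centralises \<open>A\<^sub>j\<close>, so it is in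
  \<open>Z(A\<^sub>j) \<le> Soc(A\<^sub>j)\<close>. For the socle of \<open>H\<^sub>j\<close>, the centralising conditions on the intersections
  \<open>A\<^sub>1 \<cdots> A\<^sub>i \<inter> H\<^sub>i\<close> successively split off factors \<open>a\<^sub>i \<in> Z(A\<^sub>i)\<close>, with
  \<open>a\<^sub>i \<cdots> a\<^sub>k\<close> centralising \<open>A\<^sub>i\<^sub>-\<^sub>1\<close> (\<open>head_tail_decomposition\<close>). Such products are in the socle of
  \<open>H\<^sub>j\<close> by the property claimed in the theorem, which is therefore part of the induction.
\<close>

section \<open>Classes closed under quotients and products\<close>

text \<open>
  By the first isomorphism theorem a homomorphic image is isomorphic to a quotient. Since a class
  is only given up to isomorphism, the epimorphism is first moved to a member of the class.
\<close>
lemma in_class_epimorphic_image: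
  assumes cls: "group_class \<XX>" and quot: "quotient_closed \<XX>"
    and K: "in_class \<XX> K" "group K" and L: "group L"
    and f: "f \<in> hom K L" "f ` carrier K = carrier L"
  shows "in_class \<XX> L"
proof -
  obtain M where M: "\<XX> M" "K \<cong> M" using K(1) unfolding in_class_def by blast
  interpret M: group M using cls M(1) unfolding group_class_def by blast
  obtain g where g: "g \<in> iso M K"
    using group.iso_sym[OF K(2) M(2)] unfolding is_iso_def by blast
  have gh: "g \<in> hom M K" and gi: "g ` carrier M = carrier K"
    using g by (auto simp: iso_def bij_betw_def)
  interpret fg: group_hom M L "f \<circ> g"
    using M.group_axioms L hom_compose[OF gh f(1)] by (simp add: group_hom_def group_hom_axioms_def)
  have "(f \<circ> g) ` carrier M = carrier L"
    unfolding image_comp[symmetric] gi by (rule f(2))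
  then have *: "M Mod kernel M L (f \<circ> g) \<cong> L" by (rule fg.FactGroup_iso)
  have "in_class \<XX> (M Mod kernel M L (f \<circ> g))"
    using quot M(1) fg.normal_kernel unfolding quotient_closed_def by blast
  then obtain N where N: "\<XX> N" "M Mod kernel M L (f \<circ> g) \<cong> N"
    unfolding in_class_def by blast
  have "L \<cong> M Mod kernel M L (f \<circ> g)"
    using group.iso_sym[OF normal.factorgroup_is_group[OF fg.normal_kernel] *] .
  then have "L \<cong> N" using N(2) by (rule iso_trans)
  then show ?thesis using N(1) unfolding in_class_def by blast
qed

lemma in_class_DirProd:
  assumes "product_closed \<XX>" and K: "in_class \<XX> K" "group K" and "in_class \<XX> L"
  shows "in_class \<XX> (K \<times>\<times> L)"
proof -
  obtain M N where *: "\<XX> M" "K \<cong> M" "\<XX> N" "L \<cong> N" using assms unfolding in_class_def by blast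
  then obtain P where P: "\<XX> P" "M \<times>\<times> N \<cong> P"
    using assms(1) unfolding product_closed_def in_class_def by blast
  have "K \<times>\<times> L \<cong> M \<times>\<times> N" using group.DirProd_iso_trans[OF K(2)] * by blast
  then show ?thesis using P iso_trans unfolding in_class_def by blast
qed

section \<open>Braces on subgroups\<close>

text \<open>
  A brace is a record of its own, whose multiplication is only known to agree with that of the
  ambient group on the carrier. This locale collects what is needed to compute with the
  multiplication of \<open>G\<close> alone, and with \<open>\<one>\<close> as the neutral element of both operations.
\<close>
locale brace_on = group G for G :: "('g, 'm) monoid_scheme" (structure) +
  fixes S :: "'g set" and B :: "'g ring"
  assumes brace: "skew_left_brace B"
    and S_subgroup: "subgroup S G"
    and carrier_brace: "carrier B = S"
    and mult_brace: "\<lbrakk>x \<in> S; y \<in> S\<rbrakk> \<Longrightarrow> x \<otimes>\<^bsub>B\<^esub> y = x \<otimes> y"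
begin

lemma add_group: "group (add_monoid B)"
  using brace by (rule skew_left_brace.add_group)

lemma S_carrier [simp]: "x \<in> S \<Longrightarrow> x \<in> carrier G"
  and S_one [simp]: "\<one> \<in> S"
  and S_mult [simp]: "\<lbrakk>x \<in> S; y \<in> S\<rbrakk> \<Longrightarrow> x \<otimes> y \<in> S"
  and S_inv [simp]: "x \<in> S \<Longrightarrow> inv x \<in> S"
  using S_subgroup by (auto simp: subgroup.mem_carrier subgroup.one_closed subgroup.m_closed
      subgroup.m_inv_closed)

lemma add_closed [simp]: "\<lbrakk>x \<in> S; y \<in> S\<rbrakk> \<Longrightarrow> x \<oplus>\<^bsub>B\<^esub> y \<in> S"
  and neg_closed [simp]: "x \<in> S \<Longrightarrow> \<ominus>\<^bsub>B\<^esub> x \<in> S"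
  and add_assoc: "\<lbrakk>x \<in> S; y \<in> S; z \<in> S\<rbrakk> \<Longrightarrow> (x \<oplus>\<^bsub>B\<^esub> y) \<oplus>\<^bsub>B\<^esub> z = x \<oplus>\<^bsub>B\<^esub> (y \<oplus>\<^bsub>B\<^esub> z)"
  using group.is_monoid[OF add_group, THEN monoid.m_closed]
    group.inv_closed[OF add_group] group.is_monoid[OF add_group, THEN monoid.m_assoc]
  by (auto simp: carrier_brace a_inv_def)

lemma brace_distrib:
  "\<lbrakk>x \<in> S; y \<in> S; z \<in> S\<rbrakk> \<Longrightarrow> x \<otimes> (y \<oplus>\<^bsub>B\<^esub> z) = x \<otimes> y \<oplus>\<^bsub>B\<^esub> (\<ominus>\<^bsub>B\<^esub> x) \<oplus>\<^bsub>B\<^esub> x \<otimes> z"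
  using skew_left_brace.brace_distrib[OF brace, of x y z]
  by (simp add: carrier_brace mult_brace a_minus_def)

text \<open>Distributivity at \<open>x = 1\<close>, \<open>y = z = 0\<close> gives \<open>0 = -1\<close>, so the neutral elements coincide.\<close>
lemma zero_eq_one: "\<zero>\<^bsub>B\<^esub> = \<one>"
proof -
  interpret add: group "add_monoid B" by (rule add_group)
  have z: "\<zero>\<^bsub>B\<^esub> \<in> S" using add.one_closed by (simp add: carrier_brace)
  have "\<one> \<otimes> (\<zero>\<^bsub>B\<^esub> \<oplus>\<^bsub>B\<^esub> \<zero>\<^bsub>B\<^esub>) = \<one> \<otimes> \<zero>\<^bsub>B\<^esub> \<oplus>\<^bsub>B\<^esub> (\<ominus>\<^bsub>B\<^esub> \<one>) \<oplus>\<^bsub>B\<^esub> \<one> \<otimes> \<zero>\<^bsub>B\<^esub>"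
    using z by (intro brace_distrib) auto
  then have "\<zero>\<^bsub>B\<^esub> = \<ominus>\<^bsub>B\<^esub> \<one>"
    using z add.r_one[of "\<zero>\<^bsub>B\<^esub>"] add.l_one[of "\<ominus>\<^bsub>B\<^esub> \<one>"] add.r_one[of "\<ominus>\<^bsub>B\<^esub> \<one>"]
    by (simp add: carrier_brace)
  then show ?thesis
    using add.inv_inv[of \<one>] add.inv_one by (simp add: a_inv_def carrier_brace)
qed

lemma add_one [simp]: "x \<in> S \<Longrightarrow> x \<oplus>\<^bsub>B\<^esub> \<one> = x" "x \<in> S \<Longrightarrow> \<one> \<oplus>\<^bsub>B\<^esub> x = x"
  and add_neg [simp]: "x \<in> S \<Longrightarrow> x \<oplus>\<^bsub>B\<^esub> (\<ominus>\<^bsub>B\<^esub> x) = \<one>"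
  and neg_add [simp]: "x \<in> S \<Longrightarrow> (\<ominus>\<^bsub>B\<^esub> x) \<oplus>\<^bsub>B\<^esub> x = \<one>"
  using group.is_monoid[OF add_group, THEN monoid.r_one] group.is_monoid[OF add_group, THEN monoid.l_one]
    group.r_inv[OF add_group] group.l_inv[OF add_group]
  by (auto simp: carrier_brace a_inv_def zero_eq_one)

lemma neg_unique:
  assumes "x \<in> S" "y \<in> S" "y \<oplus>\<^bsub>B\<^esub> x = \<one>"
  shows "\<ominus>\<^bsub>B\<^esub> x = y"
  using group.inv_equality[OF add_group, of y x] assms
  by (simp add: a_inv_def carrier_brace zero_eq_one)

lemma Soc_iff:
  "z \<in> brace_Soc B \<longleftrightarrow> z \<in> S \<and> (\<forall>b\<in>S. z \<otimes> b = z \<oplus>\<^bsub>B\<^esub> b \<and> z \<oplus>\<^bsub>B\<^esub> b = b \<oplus>\<^bsub>B\<^esub> z)"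
  using skew_left_brace.brace_Soc_eq[OF brace] by (auto simp: carrier_brace mult_brace)

text \<open>
  Closure under inverses: both multiplications come from \<open>G\<close>, and the negative of \<open>x\<close> in \<open>B\<close> is
  also one in \<open>C\<close>, because the sums agree and both neutral elements are \<open>\<one>\<close>.
\<close>
lemma subbraceI:
  assumes C: "brace_on G T C" and "S \<subseteq> T"
    and add: "\<And>x y. \<lbrakk>x \<in> S; y \<in> S\<rbrakk> \<Longrightarrow> x \<oplus>\<^bsub>B\<^esub> y = x \<oplus>\<^bsub>C\<^esub> y"
  shows "subbrace B C"
proof -
  interpret C: brace_on G T C by (rule C)
  interpret addC: group "add_monoid C" by (rule C.add_group)
  interpret mulC: group C using C.brace by (rule skew_left_brace.mult_group)
  have ST: "x \<in> T" if "x \<in> S" for x using that assms(2) by blast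
  have neg: "inv\<^bsub>add_monoid C\<^esub> x \<in> S" if "x \<in> S" for x
    using that ST C.neg_unique[of x "\<ominus>\<^bsub>B\<^esub> x"] by (simp add: a_inv_def[of C] flip: add)
  have "S \<noteq> {}" using S_one by blast
  have mul_neutral: "\<one>\<^bsub>C\<^esub> = \<one>"
    using mulC.l_one[of \<one>] mulC.r_cancel_one[of \<one> \<one>] C.mult_brace[of \<one> \<one>] C.carrier_brace by simp
  have minv: "inv\<^bsub>C\<^esub> x = inv x" if "x \<in> S" for x
    using that ST mulC.inv_equality[of "inv x" x] C.mult_brace[of "inv x" x]
    by (simp add: C.carrier_brace mul_neutral)
  have "subgroup S (add_monoid C)"
    by (rule addC.subgroupI)
      (use ST neg \<open>S \<noteq> {}\<close> in \<open>auto simp: C.carrier_brace simp flip: add\<close>)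
  moreover have "subgroup S C"
    by (rule mulC.subgroupI) (use ST minv \<open>S \<noteq> {}\<close> C.mult_brace in \<open>auto simp: C.carrier_brace\<close>)
  ultimately show ?thesis
    unfolding subbrace_def using ST add by (simp add: carrier_brace mult_brace C.mult_brace)
qed

end

lemma YB_structure_iff:
  assumes "group G" "subgroup S G"
  shows "YB_structure \<XX> (G\<lparr>carrier := S\<rparr>) B \<longleftrightarrow> brace_on G S B \<and> in_class \<XX> (add_monoid B)"
  using assms unfolding YB_structure_def brace_on_def brace_on_axioms_def by auto

section \<open>Subgroups normalised by another subgroup\<close>

lemma (in group) normalizer_conj_closed:
  assumes "subgroup A G" "H \<subseteq> normalizer G A" "h \<in> H" "a \<in> A"
  shows "h \<otimes> a \<otimes> inv h \<in> A"
proof -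
  have "A \<subseteq> carrier G" using assms(1) by (rule subgroup.subset)
  then have "h <# A #> inv h = A"
    using assms(2,3) by (auto simp: normalizer_def stabilizer_def)
  moreover have "h \<otimes> a \<otimes> inv h \<in> h <# A #> inv h"
    using assms(4) by (auto simp: l_coset_def r_coset_def)
  ultimately show ?thesis by simp
qed

lemma (in group) cancel_left:
  assumes "x \<in> carrier G" "y \<in> carrier G"
  shows "inv x \<otimes> (x \<otimes> y) = y" "x \<otimes> (inv x \<otimes> y) = y"
  using assms by (simp_all flip: m_assoc)

lemma (in group) normalized_product_subgroup:
  assumes A: "subgroup A G" and H: "subgroup H G"
    and conj: "\<And>h a. \<lbrakk>h \<in> H; a \<in> A\<rbrakk> \<Longrightarrow> h \<otimes> a \<otimes> inv h \<in> A"
  shows "subgroup (A <#> H) G"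
proof -
  note [simp] = subgroup.mem_carrier[OF A] subgroup.mem_carrier[OF H]
    subgroup.m_inv_closed[OF A] subgroup.m_inv_closed[OF H]
  show ?thesis
  proof (rule subgroupI)
    show "A <#> H \<subseteq> carrier G" by (auto simp: set_mult_def)
    show "A <#> H \<noteq> {}"
      using subgroup.one_closed[OF A] subgroup.one_closed[OF H] by (auto simp: set_mult_def)
  next
    fix x assume "x \<in> A <#> H"
    then obtain a h where x: "a \<in> A" "h \<in> H" "x = a \<otimes> h" by (auto simp: set_mult_def)
    have "inv x = (inv h \<otimes> inv a \<otimes> inv (inv h)) \<otimes> inv h"
      using x by (simp add: inv_mult_group m_assoc)
    moreover have "inv h \<otimes> inv a \<otimes> inv (inv h) \<in> A" using x by (intro conj) simp_all
    ultimately show "inv x \<in> A <#> H"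
      using subgroup.m_inv_closed[OF H x(2)] unfolding set_mult_def by blast
  next
    fix x y assume "x \<in> A <#> H" "y \<in> A <#> H"
    then obtain a h b g where x: "a \<in> A" "h \<in> H" "x = a \<otimes> h" and y: "b \<in> A" "g \<in> H" "y = b \<otimes> g"
      by (auto simp: set_mult_def)
    have "x \<otimes> y = (a \<otimes> (h \<otimes> b \<otimes> inv h)) \<otimes> (h \<otimes> g)"
      using x y by (simp add: m_assoc cancel_left)
    moreover have "a \<otimes> (h \<otimes> b \<otimes> inv h) \<in> A" "h \<otimes> g \<in> H"
      using x y conj subgroup.m_closed[OF A] subgroup.m_closed[OF H] by auto
    ultimately show "x \<otimes> y \<in> A <#> H" unfolding set_mult_def by blast
  qed
qed

section \<open>Gluing two braces\<close>

text \<open>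
  Two braces \<open>P\<close> and \<open>Q\<close> on subgroups \<open>A\<close> and \<open>H\<close>, where \<open>H\<close> acts on \<open>P\<close> by brace automorphisms
  through conjugation. On the external semidirect product of \<open>A\<close> by \<open>H\<close>, componentwise addition
  gives a skew left brace. The group \<open>AH\<close> is its quotient by the elements \<open>(z, z\<^sup>-\<^sup>1)\<close> with
  \<open>z \<in> A \<inter> H\<close>. The last three assumptions place these elements in the socle of the semidirect
  product, so that they form an ideal and the addition descends to \<open>AH\<close>.
\<close>
locale gluing = group G + A: brace_on G A P + H: brace_on G H Q
  for G :: "('g, 'm) monoid_scheme" (structure) and A P H Q +
  assumes conj_closed: "\<lbrakk>h \<in> H; a \<in> A\<rbrakk> \<Longrightarrow> h \<otimes> a \<otimes> inv h \<in> A"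
    and conj_add: "equivariant H (\<lambda>h a. h \<otimes> a \<otimes> inv h) P"
    and cap_centralizes: "A \<inter> H \<subseteq> centralizer G A"
    and cap_Soc_left: "A \<inter> H \<subseteq> brace_Soc P"
    and cap_Soc_right: "A \<inter> H \<subseteq> brace_Soc Q"
begin

abbreviation conj :: "'g \<Rightarrow> 'g \<Rightarrow> 'g" where "conj h a \<equiv> h \<otimes> a \<otimes> inv h"

text \<open>
  A chosen factorisation of \<open>x \<in> AH\<close>; \<open>add_glued\<close> shows that the sum does not depend on it.
\<close>
definition factors :: "'g \<Rightarrow> 'g \<times> 'g" where
  "factors x = (SOME p. p \<in> A \<times> H \<and> x = fst p \<otimes> snd p)"

definition glued :: "'g ring" where
  "glued = \<lparr>carrier = A <#> H, monoid.mult = (\<otimes>), one = \<one>, ring.zero = \<one>,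
     ring.add = (\<lambda>x y. (fst (factors x) \<oplus>\<^bsub>P\<^esub> fst (factors y)) \<otimes> (snd (factors x) \<oplus>\<^bsub>Q\<^esub> snd (factors y)))\<rparr>"

lemma glued_simps [simp]:
  "carrier glued = A <#> H" "x \<otimes>\<^bsub>glued\<^esub> y = x \<otimes> y" "\<one>\<^bsub>glued\<^esub> = \<one>" "\<zero>\<^bsub>glued\<^esub> = \<one>"
  by (simp_all add: glued_def)

lemma prodI [intro]: "\<lbrakk>a \<in> A; h \<in> H\<rbrakk> \<Longrightarrow> a \<otimes> h \<in> A <#> H"
  unfolding set_mult_def by blast

lemma prodE:
  assumes "x \<in> A <#> H"
  obtains a h where "a \<in> A" "h \<in> H" "x = a \<otimes> h"
  using assms unfolding set_mult_def by blast

lemma conj_add_eq: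
  "\<lbrakk>h \<in> H; a \<in> A; b \<in> A\<rbrakk> \<Longrightarrow> conj h (a \<oplus>\<^bsub>P\<^esub> b) = conj h a \<oplus>\<^bsub>P\<^esub> conj h b"
  using conj_add by (simp add: equivariant_def A.carrier_brace)

lemma mult_factors:
  "\<lbrakk>a \<in> A; h \<in> H; b \<in> A; g \<in> H\<rbrakk> \<Longrightarrow> (a \<otimes> h) \<otimes> (b \<otimes> g) = (a \<otimes> conj h b) \<otimes> (h \<otimes> g)"
  by (simp add: m_assoc cancel_left)

lemma cap_commute:
  assumes "z \<in> A \<inter> H" "a \<in> A"
  shows "z \<otimes> a = a \<otimes> z"
  using assms cap_centralizes unfolding centralizer_def by blast

lemma product_subgroup: "subgroup (A <#> H) G"
  by (intro normalized_product_subgroup A.S_subgroup H.S_subgroup conj_closed)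

text \<open>
  Two factorisations of the same element differ by some \<open>z \<in> A \<inter> H\<close>, as \<open>a' = az\<close> and
  \<open>h = zh'\<close>. Such a \<open>z\<close> lies in both socles, so it adds by multiplying and can be pulled out of
  the sums on both sides: to the right end of the sum in \<open>A\<close>, to the left end of the sum in \<open>H\<close>.
\<close>
lemma add_glued_well_defined:
  assumes mem: "a \<in> A" "a' \<in> A" "h \<in> H" "h' \<in> H" "b \<in> A" "b' \<in> A" "g \<in> H" "g' \<in> H"
    and eq: "a \<otimes> h = a' \<otimes> h'" "b \<otimes> g = b' \<otimes> g'"
  shows "(a \<oplus>\<^bsub>P\<^esub> b) \<otimes> (h \<oplus>\<^bsub>Q\<^esub> g) = (a' \<oplus>\<^bsub>P\<^esub> b') \<otimes> (h' \<oplus>\<^bsub>Q\<^esub> g')"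
proof -
  have shift: "\<exists>z \<in> A \<inter> H. a' = a \<otimes> z \<and> h = z \<otimes> h'"
    if "a \<in> A" "a' \<in> A" "h \<in> H" "h' \<in> H" "a \<otimes> h = a' \<otimes> h'" for a a' h h'
  proof -
    have h: "h = inv a \<otimes> a' \<otimes> h'"
      using that cancel_left(1)[of a h] by (simp add: m_assoc)
    then have "inv a \<otimes> a' = h \<otimes> inv h'"
      using that by (simp add: m_assoc)
    moreover have "inv a \<otimes> a' \<in> A" "h \<otimes> inv h' \<in> H" using that by simp_all
    ultimately have "inv a \<otimes> a' \<in> A \<inter> H" by simp
    then show ?thesis using that h
      by (intro bexI[of _ "inv a \<otimes> a'"]) (auto simp: cancel_left)
  qed
  obtain z where z: "z \<in> A \<inter> H" "a' = a \<otimes> z" "h = z \<otimes> h'" using shift mem eq by metis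
  obtain w where w: "w \<in> A \<inter> H" "b' = b \<otimes> w" "g = w \<otimes> g'" using shift mem eq by metis
  have P: "z \<otimes> c = z \<oplus>\<^bsub>P\<^esub> c" "z \<oplus>\<^bsub>P\<^esub> c = c \<oplus>\<^bsub>P\<^esub> z" "c \<otimes> z = c \<oplus>\<^bsub>P\<^esub> z"
    if "z \<in> A \<inter> H" "c \<in> A" for z c
    using that cap_Soc_left cap_commute[OF that] by (auto simp: A.Soc_iff subset_iff)
  have Q: "z \<otimes> c = z \<oplus>\<^bsub>Q\<^esub> c" "z \<oplus>\<^bsub>Q\<^esub> c = c \<oplus>\<^bsub>Q\<^esub> z"
    if "z \<in> A \<inter> H" "c \<in> H" for z c
    using that cap_Soc_right by (auto simp: H.Soc_iff subset_iff)
  have zw: "z \<in> A" "z \<in> H" "w \<in> A" "w \<in> H" "z \<otimes> w \<in> A \<inter> H" using z(1) w(1) by auto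
  have sumP: "z \<oplus>\<^bsub>P\<^esub> w = z \<otimes> w" using P(1)[OF z(1) zw(3)] by simp
  have "a' \<oplus>\<^bsub>P\<^esub> b' = (a \<oplus>\<^bsub>P\<^esub> z) \<oplus>\<^bsub>P\<^esub> (b \<oplus>\<^bsub>P\<^esub> w)"
    unfolding z(2) w(2) using P(3)[OF z(1)] P(3)[OF w(1)] mem by simp
  also have "\<dots> = a \<oplus>\<^bsub>P\<^esub> ((z \<oplus>\<^bsub>P\<^esub> b) \<oplus>\<^bsub>P\<^esub> w)"
    using mem zw by (simp add: A.add_assoc)
  also have "\<dots> = (a \<oplus>\<^bsub>P\<^esub> b) \<oplus>\<^bsub>P\<^esub> (z \<oplus>\<^bsub>P\<^esub> w)"
    unfolding P(2)[OF z(1) \<open>b \<in> A\<close>] using mem zw by (simp add: A.add_assoc)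
  also have "\<dots> = (a \<oplus>\<^bsub>P\<^esub> b) \<otimes> (z \<otimes> w)"
    unfolding sumP using mem zw P(3)[OF zw(5)] by simp
  finally have L: "a' \<oplus>\<^bsub>P\<^esub> b' = (a \<oplus>\<^bsub>P\<^esub> b) \<otimes> (z \<otimes> w)" .
  have "h \<oplus>\<^bsub>Q\<^esub> g = (z \<oplus>\<^bsub>Q\<^esub> h') \<oplus>\<^bsub>Q\<^esub> (w \<oplus>\<^bsub>Q\<^esub> g')"
    unfolding z(3) w(3) using Q(1)[OF z(1)] Q(1)[OF w(1)] mem by simp
  also have "\<dots> = z \<oplus>\<^bsub>Q\<^esub> ((h' \<oplus>\<^bsub>Q\<^esub> w) \<oplus>\<^bsub>Q\<^esub> g')"
    using mem zw by (simp add: H.add_assoc)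
  also have "\<dots> = z \<oplus>\<^bsub>Q\<^esub> (w \<oplus>\<^bsub>Q\<^esub> (h' \<oplus>\<^bsub>Q\<^esub> g'))"
    unfolding Q(2)[OF w(1) \<open>h' \<in> H\<close>, symmetric] using mem zw by (simp add: H.add_assoc)
  also have "\<dots> = z \<otimes> (w \<otimes> (h' \<oplus>\<^bsub>Q\<^esub> g'))"
    using mem zw Q(1)[OF z(1)] Q(1)[OF w(1)] by simp
  finally show ?thesis using L mem zw by (simp add: m_assoc)
qed

lemma add_glued:
  assumes "a \<in> A" "h \<in> H" "b \<in> A" "g \<in> H"
  shows "(a \<otimes> h) \<oplus>\<^bsub>glued\<^esub> (b \<otimes> g) = (a \<oplus>\<^bsub>P\<^esub> b) \<otimes> (h \<oplus>\<^bsub>Q\<^esub> g)"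
proof -
  have *: "fst (factors (a \<otimes> h)) \<in> A \<and> snd (factors (a \<otimes> h)) \<in> H \<and>
      a \<otimes> h = fst (factors (a \<otimes> h)) \<otimes> snd (factors (a \<otimes> h))" if "a \<in> A" "h \<in> H" for a h
    using someI_ex[of "\<lambda>p. p \<in> A \<times> H \<and> a \<otimes> h = fst p \<otimes> snd p"] that
    unfolding factors_def[symmetric] by (auto simp: mem_Times_iff)
  show ?thesis using assms *[of a h] *[of b g]
    by (simp add: glued_def) (intro add_glued_well_defined; simp)
qed

text \<open>
  The multiplication map exhibits the additive group of \<open>AH\<close> as an image of the direct product of
  the additive groups. This gives the group axioms and membership in the class together.
\<close>
lemma gluing_hom:
  "(\<lambda>(a, h). a \<otimes> h) \<in> hom (add_monoid P \<times>\<times> add_monoid Q) (add_monoid glued)"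
  by (auto simp: hom_def add_glued A.carrier_brace H.carrier_brace)

lemma gluing_surj:
  "(\<lambda>(a, h). a \<otimes> h) ` carrier (add_monoid P \<times>\<times> add_monoid Q) = carrier (add_monoid glued)"
  by (auto simp: A.carrier_brace H.carrier_brace elim!: prodE)

lemma add_group_glued: "group (add_monoid glued)"
proof -
  have "group (add_monoid P \<times>\<times> add_monoid Q)"
    by (intro DirProd_group A.add_group H.add_group)
  from group.hom_imp_img_group[OF this gluing_hom] show ?thesis
    unfolding gluing_surj by (simp add: A.zero_eq_one H.zero_eq_one)
qed

text \<open>
  Since \<open>(ah)(bg) = (a (h b h\<^sup>-\<^sup>1))(hg)\<close>, distributivity in the factor \<open>A\<close> involves
  \<open>h (b + d) h\<^sup>-\<^sup>1\<close>; it reduces to distributivity in \<open>P\<close> because conjugation by \<open>h\<close> is additive.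
\<close>
lemma brace_on_glued: "brace_on G (A <#> H) glued"
proof -
  have neg: "\<ominus>\<^bsub>glued\<^esub> (a \<otimes> h) = (\<ominus>\<^bsub>P\<^esub> a) \<otimes> (\<ominus>\<^bsub>Q\<^esub> h)" if "a \<in> A" "h \<in> H" for a h
    unfolding a_inv_def[of glued]
    using that by (intro group.inv_equality[OF add_group_glued]) (auto simp: add_glued)
  have "skew_left_brace glued"
  proof (intro skew_left_brace.intro add_group_glued)
    show "group glued"
      using subgroup.subgroup_is_group[OF product_subgroup group_axioms]
      unfolding group_def Group.monoid_def group_axioms_def Units_def by simp
  next
    fix x y z assume "x \<in> carrier glued" "y \<in> carrier glued" "z \<in> carrier glued"
    then obtain a h b g d k where *: "a \<in> A" "h \<in> H" "b \<in> A" "g \<in> H" "d \<in> A" "k \<in> H"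
      "x = a \<otimes> h" "y = b \<otimes> g" "z = d \<otimes> k"
      by (auto elim!: prodE)
    then have "x \<otimes> (y \<oplus>\<^bsub>glued\<^esub> z) =
        (a \<otimes> conj h b \<oplus>\<^bsub>P\<^esub> (\<ominus>\<^bsub>P\<^esub> a) \<oplus>\<^bsub>P\<^esub> a \<otimes> conj h d) \<otimes> (h \<otimes> g \<oplus>\<^bsub>Q\<^esub> (\<ominus>\<^bsub>Q\<^esub> h) \<oplus>\<^bsub>Q\<^esub> h \<otimes> k)"
      by (simp add: add_glued mult_factors conj_add_eq conj_closed A.brace_distrib H.brace_distrib
          del: H.S_mult)
    also have "\<dots> = x \<otimes> y \<oplus>\<^bsub>glued\<^esub> (\<ominus>\<^bsub>glued\<^esub> x) \<oplus>\<^bsub>glued\<^esub> x \<otimes> z"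
      using * by (simp add: add_glued mult_factors conj_closed neg)
    finally show "x \<otimes>\<^bsub>glued\<^esub> (y \<oplus>\<^bsub>glued\<^esub> z) = x \<otimes>\<^bsub>glued\<^esub> y \<ominus>\<^bsub>glued\<^esub> x \<oplus>\<^bsub>glued\<^esub> x \<otimes>\<^bsub>glued\<^esub> z"
      by (simp add: a_minus_def)
  qed
  then show ?thesis
    by (intro brace_on.intro brace_on_axioms.intro group_axioms product_subgroup) simp_all
qed

text \<open>
  Multiplication by \<open>z w\<close> twists the \<open>A\<close>-component by conjugation with \<open>w\<close>. When \<open>w\<close> centralises
  \<open>A\<close> the product is componentwise, and the two socle conditions suffice.
\<close>
lemma Soc_glued:
  assumes "z \<in> brace_Soc P" "w \<in> brace_Soc Q" "w \<in> centralizer G A"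
  shows "z \<otimes> w \<in> brace_Soc glued"
proof -
  have zw: "z \<in> A" "w \<in> H" using assms A.Soc_iff H.Soc_iff by auto
  have "(z \<otimes> w) \<otimes> x = (z \<otimes> w) \<oplus>\<^bsub>glued\<^esub> x \<and> (z \<otimes> w) \<oplus>\<^bsub>glued\<^esub> x = x \<oplus>\<^bsub>glued\<^esub> (z \<otimes> w)"
    if "x \<in> A <#> H" for x
  proof -
    obtain b g where x: "b \<in> A" "g \<in> H" "x = b \<otimes> g"
      using \<open>x \<in> A <#> H\<close> by (rule prodE)
    have "conj w b = b" using assms(3) x zw by (auto simp: centralizer_def m_assoc)
    then show ?thesis using assms x zw
      by (simp add: add_glued mult_factors) (simp add: A.Soc_iff H.Soc_iff)
  qed
  then show ?thesis using zw by (auto simp: brace_on.Soc_iff[OF brace_on_glued])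
qed

lemma subbrace_glued_left: "subbrace P glued"
proof (rule A.subbraceI[OF brace_on_glued])
  show "A \<subseteq> A <#> H" using prodI[OF _ H.S_one] by force
  show "x \<oplus>\<^bsub>P\<^esub> y = x \<oplus>\<^bsub>glued\<^esub> y" if "x \<in> A" "y \<in> A" for x y
    using that add_glued[of x \<one> y \<one>] by simp
qed

lemma H_subset: "H \<subseteq> A <#> H" using prodI[OF A.S_one] by force

lemma add_glued_right: "\<lbrakk>x \<in> H; y \<in> H\<rbrakk> \<Longrightarrow> x \<oplus>\<^bsub>glued\<^esub> y = x \<oplus>\<^bsub>Q\<^esub> y"
  using add_glued[of \<one> x \<one> y] by simp

lemma equivariant_glued:
  assumes "\<And>s. s \<in> S \<Longrightarrow> act s \<in> hom G G"
    and inv_A: "\<And>s. s \<in> S \<Longrightarrow> act s ` A \<subseteq> A" and inv_H: "\<And>s. s \<in> S \<Longrightarrow> act s ` H \<subseteq> H"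
    and "equivariant S act P" "equivariant S act Q"
  shows "equivariant S act glued"
  unfolding equivariant_def
proof (intro ballI conjI)
  fix s x y assume s: "s \<in> S" and "x \<in> carrier glued" "y \<in> carrier glued"
  then obtain a h b g where *: "a \<in> A" "h \<in> H" "b \<in> A" "g \<in> H" "x = a \<otimes> h" "y = b \<otimes> g"
    by (auto elim!: prodE)
  have mem: "act s c \<in> A" if "c \<in> A" for c using inv_A s that by blast
  have mem': "act s c \<in> H" if "c \<in> H" for c using inv_H s that by blast
  have mult: "act s (c \<otimes> d) = act s c \<otimes> act s d" if "c \<in> carrier G" "d \<in> carrier G" for c d
    using assms(1)[OF s] that by (rule hom_mult)
  show "act s (x \<otimes>\<^bsub>glued\<^esub> y) = act s x \<otimes>\<^bsub>glued\<^esub> act s y" using * by (simp add: mult)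
  show "act s (x \<oplus>\<^bsub>glued\<^esub> y) = act s x \<oplus>\<^bsub>glued\<^esub> act s y"
    using * assms(4,5) s
    by (simp add: add_glued mult mem mem' equivariant_def A.carrier_brace H.carrier_brace)
qed

end

section \<open>Ordered products of subgroups\<close>

lemma set_prod_Cons: "i \<le> j \<Longrightarrow> set_prod G A i j = A i <#>\<^bsub>G\<^esub> set_prod G A (Suc i) j"
  by (simp only: set_prod_def upt_conv_Cons[of i "Suc j"] le_imp_less_Suc list.map foldr_Cons o_apply)

lemma set_prod_empty: "j < i \<Longrightarrow> set_prod G A i j = {\<one>\<^bsub>G\<^esub>}"
  by (simp add: set_prod_def)

lemma elem_prod_Cons: "i \<le> j \<Longrightarrow> elem_prod G a i j = a i \<otimes>\<^bsub>G\<^esub> elem_prod G a (Suc i) j"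
  by (simp only: elem_prod_def upt_conv_Cons[of i "Suc j"] le_imp_less_Suc list.map foldr_Cons o_apply)

lemma elem_prod_empty: "j < i \<Longrightarrow> elem_prod G a i j = \<one>\<^bsub>G\<^esub>"
  by (simp add: elem_prod_def)

lemma elem_prod_cong:
  "(\<And>l. l \<in> {i..j} \<Longrightarrow> a l = b l) \<Longrightarrow> elem_prod G a i j = elem_prod G b i j"
  unfolding elem_prod_def by (subst map_cong[of "[i..<Suc j]" "[i..<Suc j]" a b]) (simp_all del: upt_Suc)

lemma image_set_prod_subset:
  assumes f: "f \<in> hom G G" and G: "group G"
    and A: "\<And>l. l \<in> {i..j} \<Longrightarrow> A l \<subseteq> carrier G \<and> f ` A l \<subseteq> A l" and "i \<le> Suc j"
  shows "set_prod G A i j \<subseteq> carrier G \<and> f ` set_prod G A i j \<subseteq> set_prod G A i j"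
  using \<open>i \<le> Suc j\<close> A
proof (induction i rule: inc_induct)
  case base
  show ?case using hom_one[OF f G G] G by (simp add: set_prod_empty group.is_monoid monoid.one_closed)
next
  case (step n)
  have 1: "A n \<subseteq> carrier G" "f ` A n \<subseteq> A n"
    using step.prems[of n] step.hyps by simp_all
  have 2: "set_prod G A (Suc n) j \<subseteq> carrier G" "f ` set_prod G A (Suc n) j \<subseteq> set_prod G A (Suc n) j"
    using step.IH[OF step.prems] by simp_all
  have "f x \<in> A n <#>\<^bsub>G\<^esub> set_prod G A (Suc n) j" if x: "x \<in> A n <#>\<^bsub>G\<^esub> set_prod G A (Suc n) j" for x
  proof -
    obtain a b where ab: "a \<in> A n" "b \<in> set_prod G A (Suc n) j" "x = a \<otimes>\<^bsub>G\<^esub> b"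
      using x unfolding set_mult_def by blast
    have "f x = f a \<otimes>\<^bsub>G\<^esub> f b"
      unfolding ab(3) using subsetD[OF 1(1) ab(1)] subsetD[OF 2(1) ab(2)] by (rule hom_mult[OF f])
    moreover have "f a \<in> A n" "f b \<in> set_prod G A (Suc n) j"
      using subsetD[OF 1(2) imageI[OF ab(1)]] subsetD[OF 2(2) imageI[OF ab(2)]] .
    ultimately show ?thesis unfolding set_mult_def by blast
  qed
  then have "f ` (A n <#>\<^bsub>G\<^esub> set_prod G A (Suc n) j) \<subseteq> A n <#>\<^bsub>G\<^esub> set_prod G A (Suc n) j"
    by (rule image_subsetI)
  moreover have "A n <#>\<^bsub>G\<^esub> set_prod G A (Suc n) j \<subseteq> carrier G"
    using group.setmult_subset_G[OF G 1(1) 2(1)] .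
  ultimately show ?case using step.hyps by (simp add: set_prod_Cons)
qed

lemma (in group) centralizer_set_multD:
  assumes "x \<in> centralizer G (S <#> T)" "\<one> \<in> S" "\<one> \<in> T" "S \<subseteq> carrier G" "T \<subseteq> carrier G"
  shows "x \<in> centralizer G S" "x \<in> centralizer G T"
proof -
  have *: "x \<otimes> (s \<otimes> t) = s \<otimes> t \<otimes> x" if "s \<in> S" "t \<in> T" for s t
    using assms(1) that unfolding centralizer_def set_mult_def by blast
  have x: "x \<in> carrier G" using assms(1) by (simp add: centralizer_def)
  have "x \<otimes> s = s \<otimes> x" if "s \<in> S" for s
    using *[OF that assms(3)] x that assms(4) by (simp add: subset_iff)
  then show "x \<in> centralizer G S" using x by (simp add: centralizer_def)
  have "x \<otimes> t = t \<otimes> x" if "t \<in> T" for t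
    using *[OF assms(2) that] x that assms(5) by (simp add: subset_iff)
  then show "x \<in> centralizer G T" using x by (simp add: centralizer_def)
qed

text \<open>
  The tail \<open>A\<^sub>i\<^sub>+\<^sub>1 \<cdots> A\<^sub>k\<close> is written \<open>set_prod G A (Suc i) k\<close> throughout; for \<open>i = k\<close> it is trivial.
\<close>
locale factorised_group = group G for G :: "('g, 'm) monoid_scheme" (structure) +
  fixes A :: "nat \<Rightarrow> 'g set" and k :: nat
  assumes factor_subgroup: "i \<in> {1..k} \<Longrightarrow> subgroup (A i) G"
    and last_factor: "A (Suc k) = {\<one>}"
    and tail_normalizes: "i \<in> {1..k} \<Longrightarrow> set_prod G A (Suc i) k \<subseteq> normalizer G (A i)"
    and head_tail_centralizes: "i \<in> {1..k} \<Longrightarrow>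
      set_prod G A 1 i \<inter> set_prod G A (Suc i) k \<subseteq> centralizer G (A i <#> A (Suc i))"
begin

abbreviation Z :: "nat \<Rightarrow> 'g set" where "Z i \<equiv> group_center (G\<lparr>carrier := A i\<rparr>)"

lemma factor_one: "i \<in> {1..k} \<Longrightarrow> \<one> \<in> A i"
  using factor_subgroup by (rule subgroup.one_closed)

lemma factor_carrier: "i \<in> {1..Suc k} \<Longrightarrow> A i \<subseteq> carrier G"
  using subgroup.subset[OF factor_subgroup] last_factor by (cases "i = Suc k") auto

lemma one_in_set_prod:
  assumes "1 \<le> i" "i \<le> Suc j" "j \<le> k"
  shows "\<one> \<in> set_prod G A i j"
  using assms(2,1,3)
proof (induction i rule: inc_induct)
  case base
  then show ?case by (simp add: set_prod_empty)
next
  case (step n)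
  then have "\<one> \<otimes> \<one> \<in> A n <#> set_prod G A (Suc n) j"
    using factor_one[of n] unfolding set_mult_def by (intro UN_I[of \<one>]) auto
  then show ?case using step by (simp add: set_prod_Cons)
qed

lemma set_prod_mono_right:
  assumes "1 \<le> i" "i \<le> Suc j" "j \<le> l" "l \<le> k"
  shows "set_prod G A i j \<subseteq> set_prod G A i l"
  using assms(2,1,3,4)
proof (induction i rule: inc_induct)
  case base
  then show ?case using one_in_set_prod[of "Suc j" l] by (simp add: set_prod_empty)
next
  case (step n)
  then show ?case by (simp add: set_prod_Cons mono_set_mult)
qed

lemma tail_conj_closed:
  "\<lbrakk>i \<in> {1..k}; h \<in> set_prod G A (Suc i) k; a \<in> A i\<rbrakk> \<Longrightarrow> h \<otimes> a \<otimes> inv h \<in> A i"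
  using normalizer_conj_closed factor_subgroup tail_normalizes by blast

text \<open>
  A truncated tail \<open>A\<^sub>i\<^sub>+\<^sub>1 \<cdots> A\<^sub>j\<close> is contained in the full one and hence normalises \<open>A\<^sub>i\<close>.
\<close>
lemma set_prod_subgroup:
  assumes "1 \<le> i" "i \<le> Suc j" "j \<le> k"
  shows "subgroup (set_prod G A i j) G"
  using assms(2,1,3)
proof (induction i rule: inc_induct)
  case base
  then show ?case by (simp add: set_prod_empty triv_subgroup)
next
  case (step n)
  have "subgroup (A n <#> set_prod G A (Suc n) j) G"
    using step set_prod_mono_right[of "Suc n" j k]
    by (intro normalized_product_subgroup factor_subgroup tail_conj_closed) auto
  then show ?case using step by (simp add: set_prod_Cons)
qed

lemma factor_subset_set_prod:
  assumes "1 \<le> i" "i \<le> m" "m \<le> j" "j \<le> k"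
  shows "A m \<subseteq> set_prod G A i j"
  using assms(2,1,3,4)
proof (induction i rule: inc_induct)
  case base
  have "a \<in> A m <#> set_prod G A (Suc m) j" if "a \<in> A m" for a
  proof -
    have "a = a \<otimes> \<one>" using that factor_carrier[of m] base by auto
    then show ?thesis using that one_in_set_prod[of "Suc m" j] base unfolding set_mult_def by auto
  qed
  then show ?case using base by (auto simp: set_prod_Cons)
next
  case (step n)
  have "a \<in> A n <#> set_prod G A (Suc n) j" if "a \<in> A m" for a
  proof -
    have "a = \<one> \<otimes> a" using that factor_carrier[of m] step by auto
    moreover have "a \<in> set_prod G A (Suc n) j" using step that by auto
    ultimately show ?thesis using factor_one[of n] step unfolding set_mult_def by auto
  qed
  then show ?case using step by (auto simp: set_prod_Cons)
qed

lemma Z_iff: "z \<in> Z i \<longleftrightarrow> z \<in> A i \<and> (\<forall>g \<in> A i. z \<otimes> g = g \<otimes> z)"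
  by (simp add: group_center_def)

text \<open>
  Write \<open>y = c h\<close> with \<open>c \<in> A\<^sub>n\<^sub>+\<^sub>1\<close> and \<open>h\<close> in the next tail. Then \<open>h = c\<^sup>-\<^sup>1 y\<close> also lies in the
  next head \<open>A\<^sub>1 \<cdots> A\<^sub>n\<^sub>+\<^sub>1\<close>, so the argument can be repeated with \<open>h\<close>. Both \<open>y\<close> and \<open>h\<close>
  centralise \<open>A\<^sub>n\<^sub>+\<^sub>1\<close>, one by the condition at \<open>n\<close> and the other by the condition at \<open>n + 1\<close>,
  hence \<open>c = y h\<^sup>-\<^sup>1\<close> is central in \<open>A\<^sub>n\<^sub>+\<^sub>1\<close>. The conclusion has the form of the socle criterion
  in \<open>exists_glued_brace\<close>, which will therefore apply to \<open>y\<close>.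
\<close>
lemma head_tail_decomposition:
  assumes "1 \<le> n" "n \<le> k" and "y \<in> set_prod G A 1 n \<inter> set_prod G A (Suc n) k"
  shows "\<exists>a. (\<forall>i \<in> {Suc n..k}. a i \<in> Z i) \<and> elem_prod G a (Suc n) k = y \<and>
    (\<forall>i \<in> {Suc n..k}. elem_prod G a i k \<in> centralizer G (A (i - 1)))"
  using assms(2,1,3)
proof (induction n arbitrary: y rule: inc_induct)
  case base
  then show ?case by (simp add: set_prod_empty elem_prod_empty)
next
  case (step n)
  let ?m = "Suc n"
  obtain c h where ch: "c \<in> A ?m" "h \<in> set_prod G A (Suc ?m) k" "y = c \<otimes> h"
    using step by (auto simp: set_prod_Cons set_mult_def)
  have sub: "subgroup (set_prod G A 1 ?m) G" using step by (intro set_prod_subgroup) auto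
  have carr: "c \<in> carrier G" "h \<in> carrier G"
    using ch factor_carrier[of ?m] step subgroup.mem_carrier[OF set_prod_subgroup[of "Suc ?m" k]] by auto
  have "y \<in> set_prod G A 1 ?m" using step set_prod_mono_right[of 1 n ?m] by auto
  moreover have c: "c \<in> set_prod G A 1 ?m"
    using factor_subset_set_prod[of 1 ?m ?m] step ch by auto
  ultimately have "inv c \<otimes> y \<in> set_prod G A 1 ?m"
    using sub by (simp add: subgroup.m_closed subgroup.m_inv_closed)
  then have h: "h \<in> set_prod G A 1 ?m \<inter> set_prod G A (Suc ?m) k"
    using ch carr by (simp add: cancel_left)
  then obtain a where a: "\<forall>i \<in> {Suc ?m..k}. a i \<in> Z i" "elem_prod G a (Suc ?m) k = h"
    "\<forall>i \<in> {Suc ?m..k}. elem_prod G a i k \<in> centralizer G (A (i - 1))"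
    using step.IH by auto
  have "h \<in> centralizer G (A ?m <#> A (Suc ?m))" using h head_tail_centralizes[of ?m] step by auto
  then have hC: "h \<in> centralizer G (A ?m)"
    using step factor_one factor_carrier last_factor
    by (intro centralizer_set_multD(1)[of h "A ?m" "A (Suc ?m)"]) (cases "?m = k"; auto)+
  have "y \<in> centralizer G (A n <#> A ?m)" using head_tail_centralizes[of n] step by auto
  then have yC: "y \<in> centralizer G (A n)" "y \<in> centralizer G (A ?m)"
    using step factor_one[of n] factor_one[of ?m] factor_carrier[of n] factor_carrier[of ?m]
      centralizer_set_multD[of y "A n" "A ?m"] by auto
  \<comment> \<open>\<open>c = y h\<^sup>-\<^sup>1\<close> commutes with whatever \<open>y\<close> and \<open>h\<close> commute with.\<close>
  have "c \<otimes> g = g \<otimes> c" if "g \<in> A ?m" for g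
  proof -
    have g: "g \<in> carrier G" using that factor_carrier[of ?m] step by auto
    have hg: "h \<otimes> g = g \<otimes> h" and yg: "y \<otimes> g = g \<otimes> y"
      using hC yC(2) that unfolding centralizer_def by blast+
    have "c \<otimes> g \<otimes> h = y \<otimes> g" using hg g carr ch(3) by (simp add: m_assoc)
    also have "\<dots> = g \<otimes> c \<otimes> h" unfolding yg using g carr ch(3) by (simp add: m_assoc)
    finally show ?thesis using g carr by simp
  qed
  then have cZ: "c \<in> Z ?m" using ch by (simp add: Z_iff)
  let ?a = "a(?m := c)"
  have tail: "elem_prod G ?a i k = elem_prod G a i k" if "Suc ?m \<le> i" for i
    using that by (intro elem_prod_cong) auto
  have prod: "elem_prod G ?a ?m k = y" using step a ch by (simp add: elem_prod_Cons tail)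
  have "elem_prod G ?a i k \<in> centralizer G (A (i - 1))" if "i \<in> {?m..k}" for i
    using that prod yC(1) a(3) tail[of i] by (cases "i = ?m") auto
  moreover have "?a i \<in> Z i" if "i \<in> {?m..k}" for i using that cZ a(1) by auto
  ultimately show ?case using prod by blast
qed

end

section \<open>Gluing all factors\<close>

locale factorised_brace = factorised_group G A k for G :: "('g, 'm) monoid_scheme" (structure) and A k +
  fixes B :: "nat \<Rightarrow> 'g ring"
  assumes factor_brace: "i \<in> {1..k} \<Longrightarrow> brace_on G (A i) (B i)"
    and tail_conj_add: "i \<in> {1..k} \<Longrightarrow>
      equivariant (set_prod G A (Suc i) k) (\<lambda>h a. h \<otimes> a \<otimes> inv h) (B i)"
    and center_Soc: "i \<in> {1..k} \<Longrightarrow> Z i \<subseteq> brace_Soc (B i)"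
begin

text \<open>
  The socle criterion is part of the induction: at each step it is needed for the tail, to see that
  \<open>A\<^sub>j\<close> meets the tail inside the socle of the brace already built there.
\<close>
lemma exists_glued_brace:
  assumes cls: "group_class \<XX>" "quotient_closed \<XX>" "product_closed \<XX>"
    and B_class: "\<And>i. i \<in> {1..k} \<Longrightarrow> in_class \<XX> (add_monoid (B i))"
    and act: "\<And>s. s \<in> S \<Longrightarrow> act s \<in> hom G G"
      "\<And>i s. \<lbrakk>i \<in> {1..k}; s \<in> S\<rbrakk> \<Longrightarrow> act s ` A i \<subseteq> A i"
      "\<And>i. i \<in> {1..k} \<Longrightarrow> equivariant S act (B i)"
    and j: "1 \<le> j" "j \<le> k"
  shows "\<exists>C :: 'g ring. brace_on G (set_prod G A j k) C \<and> in_class \<XX> (add_monoid C) \<and>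
    equivariant S act C \<and>
    (\<forall>a. (\<forall>i \<in> {j..k}. a i \<in> Z i) \<longrightarrow>
         (\<forall>i \<in> {Suc j..k}. elem_prod G a i k \<in> centralizer G (A (i - 1))) \<longrightarrow>
         elem_prod G a j k \<in> brace_Soc C) \<and>
    (\<forall>i \<in> {j..k}. subbrace (B i) C)"
  using j(2,1)
proof (induction j rule: inc_induct)
  case base
  interpret Bk: brace_on G "A k" "B k" using base by (intro factor_brace) simp
  have prod: "set_prod G A k k = A k"
    using factor_carrier[of k] base by (auto simp: set_prod_Cons set_prod_empty set_mult_def)
  have "elem_prod G a k k \<in> brace_Soc (B k)" if "a k \<in> Z k" for a
    using that center_Soc[of k] base by (auto simp: elem_prod_Cons elem_prod_empty Z_iff)
  moreover have "subbrace (B k) (B k)" by (rule Bk.subbraceI[OF Bk.brace_on_axioms]) auto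
  ultimately show ?case
    using base B_class[of k] act(3)[of k] Bk.brace_on_axioms
    by (intro exI[of _ "B k"]) (simp add: prod)
next
  case (step j)
  let ?H = "set_prod G A (Suc j) k"
  have j: "j \<in> {1..k}" using step by auto
  obtain Q where Q: "brace_on G ?H Q" "in_class \<XX> (add_monoid Q)" "equivariant S act Q"
    and Q_Soc: "\<And>a. \<lbrakk>\<And>i. i \<in> {Suc j..k} \<Longrightarrow> a i \<in> Z i;
         \<And>i. i \<in> {Suc (Suc j)..k} \<Longrightarrow> elem_prod G a i k \<in> centralizer G (A (i - 1))\<rbrakk> \<Longrightarrow>
         elem_prod G a (Suc j) k \<in> brace_Soc Q"
    and Q_sub: "\<And>i. i \<in> {Suc j..k} \<Longrightarrow> subbrace (B i) Q"
    using step.IH by auto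
  have cap: "x \<in> set_prod G A 1 j \<inter> ?H" if "x \<in> A j \<inter> ?H" for x
    using that factor_subset_set_prod[of 1 j j] j by auto
  have cap_C: "A j \<inter> ?H \<subseteq> centralizer G (A j)"
  proof
    fix x assume "x \<in> A j \<inter> ?H"
    then have "x \<in> centralizer G (A j <#> A (Suc j))" using cap head_tail_centralizes[OF j] by blast
    then show "x \<in> centralizer G (A j)"
      using j factor_one[of j] factor_one[of "Suc j"] factor_carrier[of j] factor_carrier[of "Suc j"] step
      by (intro centralizer_set_multD(1)[of x "A j" "A (Suc j)"]) auto
  qed
  have cap_SocQ: "A j \<inter> ?H \<subseteq> brace_Soc Q"
  proof
    fix x assume "x \<in> A j \<inter> ?H"
    then obtain a where "\<forall>i \<in> {Suc j..k}. a i \<in> Z i" "elem_prod G a (Suc j) k = x"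
      "\<forall>i \<in> {Suc j..k}. elem_prod G a i k \<in> centralizer G (A (i - 1))"
      using head_tail_decomposition[of j x] cap j by auto
    then show "x \<in> brace_Soc Q" using Q_Soc[of a] by auto
  qed
  have cap_SocB: "A j \<inter> ?H \<subseteq> brace_Soc (B j)"
  proof
    fix x assume x: "x \<in> A j \<inter> ?H"
    then have "x \<in> Z j" using cap_C by (simp add: Z_iff centralizer_def subset_iff)
    then show "x \<in> brace_Soc (B j)" using center_Soc[OF j] by blast
  qed
  interpret gluing G "A j" "B j" ?H Q
    using j cap_C cap_SocQ cap_SocB Q(1) factor_brace tail_conj_add tail_conj_closed
    by (intro gluing.intro gluing_axioms.intro group_axioms) auto
  have prod: "set_prod G A j k = A j <#> ?H" using j by (simp add: set_prod_Cons)
  have "in_class \<XX> (add_monoid glued)"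
    using cls B_class[OF j] Q(2) A.add_group H.add_group
    by (intro in_class_epimorphic_image[OF cls(1,2) _ _ add_group_glued gluing_hom gluing_surj]
        in_class_DirProd DirProd_group)
  moreover have "equivariant S act glued"
  proof (rule equivariant_glued[OF act(1)])
    show "act s ` ?H \<subseteq> ?H" if "s \<in> S" for s
    proof (rule conjunct2[OF image_set_prod_subset[OF act(1)[OF that] group_axioms]])
      show "A l \<subseteq> carrier G \<and> act s ` A l \<subseteq> A l" if "l \<in> {Suc j..k}" for l
        using that by (intro conjI factor_carrier act(2) \<open>s \<in> S\<close>) simp_all
    qed (use j in simp)
  qed (use act(2)[OF j] act(3)[OF j] Q(3) in simp_all)
  moreover have "elem_prod G a j k \<in> brace_Soc glued"
    if "\<forall>i \<in> {j..k}. a i \<in> Z i"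
      and "\<forall>i \<in> {Suc j..k}. elem_prod G a i k \<in> centralizer G (A (i - 1))" for a
  proof -
    have "a j \<in> brace_Soc (B j)" using that center_Soc[OF j] j by auto
    moreover have "elem_prod G a (Suc j) k \<in> brace_Soc Q" using that by (intro Q_Soc) auto
    moreover have "elem_prod G a (Suc j) k \<in> centralizer G (A j)" using bspec[OF that(2), of "Suc j"] step by auto
    ultimately show ?thesis using j by (simp add: elem_prod_Cons Soc_glued)
  qed
  moreover have "subbrace (B i) glued" if "i \<in> {j..k}" for i
  proof (cases "i = j")
    case True
    then show ?thesis using subbrace_glued_left by simp
  next
    case False
    then have i: "i \<in> {Suc j..k}" using that by auto
    interpret Bi: brace_on G "A i" "B i" using i by (intro factor_brace) auto
    have sub: "A i \<subseteq> ?H" using i j by (intro factor_subset_set_prod) auto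
    show ?thesis
      using Q_sub[OF i] sub H_subset
      by (intro Bi.subbraceI[OF brace_on_glued])
        (auto simp: subbrace_def Bi.carrier_brace add_glued_right subset_iff)
  qed
  ultimately show ?case using brace_on_glued by (intro exI[of _ glued]) (simp add: prod)
qed

end

theorem theorem3:
  fixes \<XX> :: "'u monoid \<Rightarrow> bool"
    and Act :: "'a monoid" and \<phi> :: "'a \<Rightarrow> 'g \<Rightarrow> 'g"
    and G :: "'g monoid"
    and A H :: "nat \<Rightarrow> 'g set" and B :: "nat \<Rightarrow> 'g ring" and k :: nat
  assumes "group_class \<XX>" and "quotient_closed \<XX>" and "product_closed \<XX>"
    and "group Act" and "group G" and "\<phi> \<in> hom Act (AutoGroup G)"
    and "1 \<le> k"
    and "\<And>i. i \<in> {1..k} \<Longrightarrow> subgroup (A i) G"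
    and "\<And>i x. i \<in> {1..k} \<Longrightarrow> x \<in> carrier Act \<Longrightarrow> \<phi> x ` A i \<subseteq> A i"
    and "carrier G = set_prod G A 1 k"
    and "H 0 = carrier G"
    and "\<And>i. i \<in> {1..k - 1} \<Longrightarrow> H i = set_prod G A (i + 1) k"
    and "A (k + 1) = {\<one>\<^bsub>G\<^esub>}" and "H k = {\<one>\<^bsub>G\<^esub>}"
    and "\<And>i. i \<in> {1..k} \<Longrightarrow> YB_structure \<XX> (G\<lparr>carrier := A i\<rparr>) (B i)"
    and "\<And>i. i \<in> {1..k} \<Longrightarrow> equivariant (carrier Act) \<phi> (B i)"
    and "\<And>i. i \<in> {1..k} \<Longrightarrow> H i \<subseteq> normalizer G (A i)"
    and "\<And>i. i \<in> {1..k} \<Longrightarrow> equivariant (H i) (\<lambda>h a. h \<otimes>\<^bsub>G\<^esub> a \<otimes>\<^bsub>G\<^esub> inv\<^bsub>G\<^esub> h) (B i)"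
    and "\<And>i. i \<in> {1..k} \<Longrightarrow>
           set_prod G A 1 i \<inter> H i \<subseteq> centralizer G (A i <#>\<^bsub>G\<^esub> A (i + 1))"
    and "\<And>i. i \<in> {1..k} \<Longrightarrow> group_center (G\<lparr>carrier := A i\<rparr>) \<subseteq> brace_Soc (B i)"
  shows "\<exists>C :: 'g ring.
    YB_structure \<XX> G C \<and> equivariant (carrier Act) \<phi> C \<and>
    (\<forall>a. (\<forall>i \<in> {1..k}. a i \<in> group_center (G\<lparr>carrier := A i\<rparr>)) \<longrightarrow>
         (\<forall>i \<in> {2..k}. elem_prod G a i k \<in> centralizer G (A (i - 1))) \<longrightarrow>
         elem_prod G a 1 k \<in> brace_Soc C) \<and>
    (\<forall>i \<in> {1..k}. subbrace (B i) C)"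
proof -
  have H: "H i = set_prod G A (Suc i) k" if "i \<in> {1..k}" for i
    using that assms(12)[of i] assms(14) by (cases "i = k") (auto simp: set_prod_empty)
  have YB: "brace_on G (A i) (B i)" "in_class \<XX> (add_monoid (B i))" if "i \<in> {1..k}" for i
    using assms(15)[OF that] assms(8)[OF that] assms(5) by (simp_all add: YB_structure_iff)
  have \<phi>: "\<phi> s \<in> hom G G" if "s \<in> carrier Act" for s
    using hom_carrier[OF assms(6)] that by (auto simp: AutoGroup_def auto_def)
  interpret group G by (rule assms(5))
  interpret factorised_brace G A k B
  proof (intro factorised_brace.intro factorised_group.intro factorised_group_axioms.intro
      factorised_brace_axioms.intro group_axioms)
    fix i assume i: "i \<in> {1..k}"
    show "subgroup (A i) G" by (rule assms(8)[OF i])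
    show "set_prod G A (Suc i) k \<subseteq> normalizer G (A i)" using assms(17)[OF i] H[OF i] by simp
    show "set_prod G A 1 i \<inter> set_prod G A (Suc i) k \<subseteq> centralizer G (A i <#>\<^bsub>G\<^esub> A (Suc i))"
      using assms(19)[OF i] H[OF i] by simp
    show "brace_on G (A i) (B i)" by (rule YB(1)[OF i])
    show "equivariant (set_prod G A (Suc i) k) (\<lambda>h a. h \<otimes>\<^bsub>G\<^esub> a \<otimes>\<^bsub>G\<^esub> inv\<^bsub>G\<^esub> h) (B i)"
      using assms(18)[OF i] H[OF i] by simp
    show "group_center (G\<lparr>carrier := A i\<rparr>) \<subseteq> brace_Soc (B i)" by (rule assms(20)[OF i])
  qed (use assms(13) in simp)
  have "YB_structure \<XX> G C \<longleftrightarrow> brace_on G (carrier G) C \<and> in_class \<XX> (add_monoid C)" for C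
    using YB_structure_iff[OF assms(5) subgroup_self, of \<XX> C] by simp
  then show ?thesis
    using exists_glued_brace[OF assms(1-3) YB(2) \<phi> assms(9,16) order.refl assms(7)]
    by (simp add: assms(10) numeral_2_eq_2)
qed

end
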